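(* Assume that the distribution $P$ is such that the ratio of base rates equals one, i.e. $r=s$. Denote an attribute classifier $h$ as a tuple $(g_1,g_2)$, where $g_1$ and $g_2$ are its conditional errors. Then, under a given error budget $U$, i.e. $\mathbb{P}(h(x)\neq a,\,y=1)=U$, the only global maximizers of the distortion factor $$\gamma=\frac{|1-g_1-g_2|}{\big(\frac{s}{r}(1-g_1)+g_2\big)\big(\frac{r}{s}(1-g_2)+g_1\big)}$$ are the attribute classifiers $(0,U/r)$ and $(U/r,0)$ (if $U\leq r$) or $(U/r-1,1)$ and $(1,U/r-1)$ (if $U\geq r$).
   Context: $P$ is a probability distribution over triples $(x,y,a)\in\mathcal{X}\times\mathcal{Y}\times\mathcal{A}$, where $\mathcal{X}$ is a feature space, $\mathcal{Y}=\{-1,+1\}$ is the label space and $\mathcal{A}=\{0,1\}$ is the sensitive attribute space. Put $r=\mathbb{P}(y=1,a=1)$ and $s=\mathbb{P}(y=1,a=0)$; the quantity $r/s$ is called the ratio of base rates and is assumed to lie in $(0,G)$ for some finite $G$. An attribute classifier is a map $h:\mathcal{X}\to\mathcal{A}$; its conditional errors are $g_1=\mathbb{P}(h(x)\neq a\mid a=0,y=1)$ and $g_2=\mathbb{P}(h(x)\neq a\mid a=1,y=1)$, so that $\mathbb{P}(h(x)\neq a,y=1)=s g_1+r g_2$. The maximization is over all pairs $(g_1,g_2)\in[0,1]^2$ satisfying the budget constraint $s g_1+r g_2=U$ (so $0\le U\le r+s$). When $g_1+g_2=1$, the distortion factor $\gamma$ is taken to be zero.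
   Formalization: "Only" is claimed just for U<r and U>r; at U=r the listed classifiers are shown to be global maximizers but not the only ones, because there the budget forces g1+g2=1, so γ is zero on all feasible pairs and e.g. (1/2,1/2) is also a maximizer. *)

theory Defs
  imports "HOL-Probability.Probability"
begin

text \<open>
  A triple \<open>(x, y, a)\<close> carries a feature, a label in \<open>{-1, 1}\<close> and a sensitive attribute in
  \<open>{0, 1}\<close>; \<open>M\<close> is the measurable space of features.
\<close>

definition triple_space :: "'x measure \<Rightarrow> ('x \<times> int \<times> nat) measure" where
  "triple_space M = M \<Otimes>\<^sub>M (count_space {-1, 1} \<Otimes>\<^sub>M count_space {0, 1})"

text \<open>\<open>base_rate P 1\<close> is \<open>r\<close> and \<open>base_rate P 0\<close> is \<open>s\<close>.\<close>

definition base_rate :: "('x \<times> int \<times> nat) measure \<Rightarrow> nat \<Rightarrow> real" where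
  "base_rate P b = \<P>((x, y, a) in P. y = 1 \<and> a = b)"

definition attribute_classifier :: "'x measure \<Rightarrow> ('x \<Rightarrow> nat) \<Rightarrow> bool" where
  "attribute_classifier M h \<longleftrightarrow> h \<in> M \<rightarrow>\<^sub>M count_space {0, 1}"

definition attribute_error :: "('x \<times> int \<times> nat) measure \<Rightarrow> ('x \<Rightarrow> nat) \<Rightarrow> real" where
  "attribute_error P h = \<P>((x, y, a) in P. h x \<noteq> a \<and> y = 1)"

definition conditional_error :: "('x \<times> int \<times> nat) measure \<Rightarrow> ('x \<Rightarrow> nat) \<Rightarrow> nat \<Rightarrow> real" where
  "conditional_error P h b = \<P>((x, y, a) in P. h x \<noteq> a \<bar> a = b \<and> y = 1)"

text \<open>The tuple \<open>(g\<^sub>1, g\<^sub>2)\<close> denoting a classifier; \<open>g\<^sub>1\<close> conditions on \<open>a = 0\<close>, \<open>g\<^sub>2\<close> on \<open>a = 1\<close>.\<close>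

definition error_pair :: "('x \<times> int \<times> nat) measure \<Rightarrow> ('x \<Rightarrow> nat) \<Rightarrow> real \<times> real" where
  "error_pair P h = (conditional_error P h 0, conditional_error P h 1)"

definition budget_pairs :: "real \<Rightarrow> real \<Rightarrow> real \<Rightarrow> (real \<times> real) set" where
  "budget_pairs r s U = {(g1, g2). g1 \<in> {0..1} \<and> g2 \<in> {0..1} \<and> s * g1 + r * g2 = U}"

text \<open>The numerator vanishes when \<open>g\<^sub>1 + g\<^sub>2 = 1\<close>, so \<open>x / 0 = 0\<close> already gives the value zero there;
  the case distinction states this convention explicitly.\<close>

definition distortion_factor :: "real \<Rightarrow> real \<Rightarrow> real \<times> real \<Rightarrow> real" where
  "distortion_factor r s = (\<lambda>(g1, g2).
     if g1 + g2 = 1 then 0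
     else \<bar>1 - g1 - g2\<bar> / ((s / r * (1 - g1) + g2) * (r / s * (1 - g2) + g1)))"

definition global_maximizers :: "real \<Rightarrow> real \<Rightarrow> real \<Rightarrow> (real \<times> real) set" where
  "global_maximizers r s U =
     {g. is_arg_max (distortion_factor r s) (\<lambda>g. g \<in> budget_pairs r s U) g}"

text \<open>
  With equal base rates and \<open>U = r\<close> the budget forces \<open>g\<^sub>1 + g\<^sub>2 = 1\<close>, so the distortion factor
  is identically zero and every feasible pair is a maximizer. Uniqueness of the maximizers
  can therefore only be claimed for \<open>U \<noteq> r\<close>.
\<close>

lemma global_maximizers_degenerate_budget:
  assumes "r > 0"
  shows "global_maximizers r r r = {(g1, g2). g1 \<in> {0..1} \<and> g2 \<in> {0..1} \<and> g1 + g2 = 1}"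
proof -
  have "r * g1 + r * g2 = r \<longleftrightarrow> g1 + g2 = 1" for g1 g2 :: real
    using assms by (metis distrib_left mult_cancel_left2 less_irrefl)
  then show ?thesis
    by (auto simp: global_maximizers_def is_arg_max_def budget_pairs_def distortion_factor_def)
qed

end

theory Submission
  imports Defs
begin

text \<open>
  For \<open>r = s\<close> the distortion factor equals \<open>\<bar>1 - t\<bar> / (1 - d\<^sup>2)\<close> with \<open>t = g\<^sub>1 + g\<^sub>2\<close> and
  \<open>d = g\<^sub>1 - g\<^sub>2\<close>. The budget fixes \<open>t = U / r\<close>, so for \<open>t \<noteq> 1\<close> the maximizers are the feasible
  pairs with the largest \<open>\<bar>d\<bar>\<close>, which are the end points of the segment \<open>g\<^sub>1 + g\<^sub>2 = t\<close> in the
  unit square.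
\<close>

lemma conditional_error_mult_base_rate:
  assumes "base_rate P b \<noteq> 0"
  shows "base_rate P b * conditional_error P h b
    = \<P>(p in P. h (fst p) \<noteq> snd (snd p) \<and> snd (snd p) = b \<and> fst (snd p) = 1)"
proof -
  have "base_rate P b = \<P>(p in P. snd (snd p) = b \<and> fst (snd p) = 1)"
    unfolding base_rate_def by (rule arg_cong[where f = "measure P"]) auto
  then show ?thesis
    using assms by (simp add: conditional_error_def cond_prob_def case_prod_beta)
qed

text \<open>Splitting the error event by the value of the attribute turns the probabilistic budget
  into the linear constraint of \<open>budget_pairs\<close>.\<close>

lemma error_budget:
  fixes P :: "('x \<times> int \<times> nat) measure"
  assumes "prob_space P" and sets: "sets P = sets (triple_space M)"
    and h: "attribute_classifier M h"
    and nz: "base_rate P 0 \<noteq> 0" "base_rate P 1 \<noteq> 0"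
  shows "base_rate P 0 * conditional_error P h 0 + base_rate P 1 * conditional_error P h 1
    = attribute_error P h"
proof -
  interpret prob_space P by fact
  have sp: "space P = space M \<times> {-1, 1} \<times> {0, 1}"
    using sets_eq_imp_space_eq[OF sets] by (simp add: triple_space_def space_pair_measure)
  define E where
    "E b = {p \<in> space P. h (fst p) \<noteq> snd (snd p) \<and> snd (snd p) = b \<and> fst (snd p) = 1}" for b
  \<comment> \<open>Additivity below needs measurable events. Since \<open>h\<close> is measurable
    with values in \<open>{0, 1}\<close>, each \<open>E b\<close> is a measurable rectangle.\<close>
  have E: "E b \<in> sets P" if b: "b \<in> {0, 1}" for b
  proof -
    have "h -` ({0, 1} - {b}) \<inter> space M \<in> sets M"
      using h by (auto simp: attribute_classifier_def intro: measurable_sets)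
    then have "(h -` ({0, 1} - {b}) \<inter> space M) \<times> {1} \<times> {b} \<in> sets P"
      unfolding sets triple_space_def using b by (intro pair_measureI) auto
    moreover have "h x \<in> {0, 1}" if "x \<in> space M" for x
      using h that measurable_space[of h M "count_space {0, 1}" x]
      by (simp add: attribute_classifier_def)
    then have "E b = (h -` ({0, 1} - {b}) \<inter> space M) \<times> {1} \<times> {b}"
      using b unfolding E_def sp by fastforce
    ultimately show ?thesis by simp
  qed
  have "attribute_error P h = prob (E 0 \<union> E 1)"
    unfolding attribute_error_def
    by (rule arg_cong[where f = prob]) (auto simp: E_def sp)
  also have "\<dots> = prob (E 0) + prob (E 1)"
    by (rule finite_measure_Union) (auto intro: E, auto simp: E_def)
  finally show ?thesis
    using nz by (simp add: conditional_error_mult_base_rate E_def)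
qed

text \<open>Monotonicity asks measurability only of the larger event, that of \<open>R\<close>. If
  this event is not measurable, its measure is 0 and division by zero makes the quotient 0.\<close>

lemma (in prob_space) cond_prob_le_1: "\<P>(x in M. Q x \<bar> R x) \<le> 1"
proof (cases "{x \<in> space M. R x} \<in> events")
  case True
  then show ?thesis
    by (auto simp: cond_prob_def divide_le_eq_1 zero_less_measure_iff
        intro!: finite_measure_mono)
next
  case False
  then show ?thesis by (simp add: cond_prob_def measure_notin_sets)
qed

lemma conditional_error_in_unit_interval:
  assumes "prob_space P"
  shows "conditional_error P h b \<in> {0..1}"
proof -
  interpret prob_space P by fact
  show ?thesis
    using cond_prob_le_1 by (simp add: conditional_error_def) (simp add: cond_prob_def)
qed

lemma mem_budget_pairs_equal_rates:
  assumes "r > 0"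
  shows "(g1, g2) \<in> budget_pairs r r U
    \<longleftrightarrow> g1 \<in> {0..1} \<and> g2 \<in> {0..1} \<and> g1 + g2 = U / r"
  using assms by (auto simp: budget_pairs_def field_simps)

lemma distortion_factor_equal_rates:
  assumes "r > 0"
  shows "distortion_factor r r (g1, g2) = \<bar>1 - (g1 + g2)\<bar> / (1 - (g1 - g2)\<^sup>2)"
proof -
  have "(1 - g1 + g2) * (1 - g2 + g1) = 1 - (g1 - g2)\<^sup>2"
    by (simp add: power2_eq_square algebra_simps)
  \<comment> \<open>The separate case \<open>g1 + g2 = 1\<close> of the definition fits the formula
    because the numerator is 0 there.\<close>
  then show ?thesis
    using assms by (simp add: distortion_factor_def diff_diff_eq)
qed

text \<open>With the numerator fixed by the budget, the factor grows strictly with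
  \<open>\<bar>g1 - g2\<bar>\<close> as long as this stays below 1. The bound \<open>D\<close> is
  left abstract so that both budget ranges can supply their own.\<close>

lemma global_maximizers_equal_rates:
  assumes r: "r > 0" and U: "U \<noteq> r" and D: "D < 1"
    and bound: "\<And>g1 g2. (g1, g2) \<in> budget_pairs r r U \<Longrightarrow> \<bar>g1 - g2\<bar> \<le> D"
    and attained: "(e1, e2) \<in> budget_pairs r r U" "\<bar>e1 - e2\<bar> = D"
  shows "global_maximizers r r U = {(g1, g2) \<in> budget_pairs r r U. \<bar>g1 - g2\<bar> = D}"
proof -
  define c where "c = \<bar>1 - U / r\<bar>"
  \<comment> \<open>Here \<open>U \<noteq> r\<close> enters: a positive numerator makes the
    comparison in \<open>less\<close> strict.\<close>
  have c: "c > 0" using r U by (simp add: c_def field_simps)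
  have val: "distortion_factor r r (g1, g2) = c / (1 - \<bar>g1 - g2\<bar>\<^sup>2)"
    if "(g1, g2) \<in> budget_pairs r r U" for g1 g2
    using that r by (simp add: distortion_factor_equal_rates mem_budget_pairs_equal_rates c_def)
  have D0: "0 \<le> D" using attained by linarith
  have pos: "0 < 1 - D\<^sup>2" using D D0 by (simp add: power_less_one_iff abs_square_less_1)
  have le: "c / (1 - \<bar>g1 - g2\<bar>\<^sup>2) \<le> c / (1 - D\<^sup>2)" if "(g1, g2) \<in> budget_pairs r r U" for g1 g2
    using c pos power_mono[OF bound[OF that], of 2] by (intro divide_left_mono mult_pos_pos) auto
  have less: "c / (1 - \<bar>g1 - g2\<bar>\<^sup>2) < c / (1 - D\<^sup>2)"
    if "(g1, g2) \<in> budget_pairs r r U" "\<bar>g1 - g2\<bar> \<noteq> D" for g1 g2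
  proof -
    have "\<bar>g1 - g2\<bar>\<^sup>2 < D\<^sup>2" using bound[OF that(1)] that(2) by (intro power_strict_mono) auto
    then show ?thesis using c pos by (intro divide_strict_left_mono mult_pos_pos) auto
  qed
  show ?thesis
  proof (intro set_eqI iffI)
    fix g assume "g \<in> global_maximizers r r U"
    then have g: "g \<in> budget_pairs r r U"
      and max: "\<not> distortion_factor r r g < distortion_factor r r (e1, e2)"
      using attained(1) by (auto simp: global_maximizers_def is_arg_max_def)
    then show "g \<in> {(g1, g2) \<in> budget_pairs r r U. \<bar>g1 - g2\<bar> = D}"
      using less attained val by (cases g) auto
  next
    fix g assume "g \<in> {(g1, g2) \<in> budget_pairs r r U. \<bar>g1 - g2\<bar> = D}"
    then show "g \<in> global_maximizers r r U"
      using le by (fastforce simp: global_maximizers_def is_arg_max_def val not_less)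
  qed
qed

text \<open>For nonnegative errors \<open>\<bar>g1 - g2\<bar> \<le> g1 + g2 = U / r\<close>, with
  equality exactly when one of them is 0.\<close>

lemma global_maximizers_small_budget:
  assumes "0 < r" "0 \<le> U" "U < r"
  shows "global_maximizers r r U = {(0, U / r), (U / r, 0)}"
proof -
  have t: "0 \<le> U / r" "U / r < 1" using assms by simp_all
  have "global_maximizers r r U = {(g1, g2) \<in> budget_pairs r r U. \<bar>g1 - g2\<bar> = U / r}"
    using assms t
    by (intro global_maximizers_equal_rates[where ?e1.0 = 0 and ?e2.0 = "U / r"])
      (auto simp: mem_budget_pairs_equal_rates)
  also have "\<dots> = {(0, U / r), (U / r, 0)}"
    using t mem_budget_pairs_equal_rates[OF assms(1)]
    \<comment> \<open>Deleting the rule keeps \<open>0 \<le> U / r\<close> from being rewritten into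
      sign conditions on \<open>U\<close> and \<open>r\<close>.\<close>
    by (auto simp del: zero_le_divide_iff simp: abs_if split: if_splits)
  finally show ?thesis .
qed

text \<open>Since \<open>\<bar>g1 - g2\<bar> = 2 * max g1 g2 - U / r\<close>, the largest difference
  is \<open>2 - U / r\<close>, reached exactly when one error is 1; it is below 1 because
  \<open>r < U\<close>.\<close>

lemma global_maximizers_large_budget:
  assumes "0 < r" "r < U" "U \<le> 2 * r"
  shows "global_maximizers r r U = {(U / r - 1, 1), (1, U / r - 1)}"
proof -
  have t: "1 < U / r" "U / r \<le> 2" using assms by (auto simp: field_simps)
  have "global_maximizers r r U = {(g1, g2) \<in> budget_pairs r r U. \<bar>g1 - g2\<bar> = 2 - U / r}"
    using assms t
    by (intro global_maximizers_equal_rates[where ?e1.0 = 1 and ?e2.0 = "U / r - 1"])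
      (auto simp: mem_budget_pairs_equal_rates)
  also have "\<dots> = {(U / r - 1, 1), (1, U / r - 1)}"
    using assms t by (auto simp: mem_budget_pairs_equal_rates abs_if split: if_splits)
  finally show ?thesis .
qed

theorem theorem2:
  fixes M :: "'x measure" and P :: "('x \<times> int \<times> nat) measure" and r s G U :: real
  assumes "prob_space P" and "sets P = sets (triple_space M)"
    and "r = base_rate P 1" and "s = base_rate P 0"
    and "s \<noteq> 0" and "r / s \<in> {0<..<G}"
    and "r = s"
    and "0 \<le> U" and "U \<le> r + s"
  shows "(\<forall>h. attribute_classifier M h \<and> attribute_error P h = U
             \<longrightarrow> error_pair P h \<in> budget_pairs r s U)
    \<and> (U \<le> r \<longrightarrow> {(0, U / r), (U / r, 0)} \<subseteq> global_maximizers r s U)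
    \<and> (U \<ge> r \<longrightarrow> {(U / r - 1, 1), (1, U / r - 1)} \<subseteq> global_maximizers r s U)
    \<and> (U < r \<longrightarrow> global_maximizers r s U = {(0, U / r), (U / r, 0)})
    \<and> (U > r \<longrightarrow> global_maximizers r s U = {(U / r - 1, 1), (1, U / r - 1)})"
proof -
  have r: "r > 0" using assms(3,5,7) by (simp add: base_rate_def less_le)
  have "error_pair P h \<in> budget_pairs r s U"
    if "attribute_classifier M h" "attribute_error P h = U" for h
    using error_budget[OF assms(1,2) that(1)] that(2) assms(3-5,7)
      conditional_error_in_unit_interval[OF assms(1)]
    by (simp add: error_pair_def budget_pairs_def)
  moreover have "global_maximizers r s U = {(0, U / r), (U / r, 0)}" if "U < r"
    using global_maximizers_small_budget r that assms(7,8) by blast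
  moreover have "global_maximizers r s U = {(U / r - 1, 1), (1, U / r - 1)}" if "U > r"
    using global_maximizers_large_budget[of r U] r that assms(7,9) by simp
  \<comment> \<open>At \<open>U = r\<close> both listed sets become \<open>{(0, 1), (1, 0)}\<close>.
    Every feasible pair is then a maximizer, so only inclusion holds.\<close>
  moreover have "{(0, 1), (1, 0)} \<subseteq> global_maximizers r s U" if "U = r"
    using global_maximizers_degenerate_budget[OF r] that assms(7) by auto
  ultimately show ?thesis
    using r by (cases U r rule: linorder_cases) auto
qed

end
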